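(* Let $R$ be a dependency matrix for a spin system with $n$ sites. Suppose that $R$ is symmetric with zero diagonal and $\|R\|_2=\lambda(R)=\lambda<1$. Then the mixing time $\tau_{\mathrm s}(\varepsilon)$ (number of complete scans) of systematic scan Glauber dynamics is asymptotically at most $$\hat\tau_{\mathrm s}(\varepsilon)\sim\big(1-\tfrac12\lambda\big)(1-\lambda)^{-1}\ln\big((1-\lambda)^{-1}n/\varepsilon\big),$$ that is, for fixed $\varepsilon\in(0,1)$ and any sequence of such systems, one for each $n$ (with $R$ and $\lambda$ possibly depending on $n$), $$\limsup_{n\to\infty}\frac{\tau_{\mathrm s}(\varepsilon)}{(1-\frac12\lambda)(1-\lambda)^{-1}\ln((1-\lambda)^{-1}n/\varepsilon)}\le1 .$$
   Context: Spin system: the sites are $V=[n]=\{1,\dots,n\}$, the spins are a finite set $\Sigma=[q]$, and $\Omega^+=\Sigma^n$ is the set of configurations; $\pi$ is a probability distribution on $\Omega^+$. For a site $j$, $S_j$ is the set of pairs $(x,y)\in\Omega^+\times\Omega^+$ with $x_i=y_i$ for all $i\ne j$; $x\to^j c$ is the configuration that agrees with $x$ off $j$ and has spin $c$ at $j$. For each site $j$ there is a transition matrix $P^{[j]}$ on $\Omega^+$ such that $P^{[j]}(x,y)>0$ implies $(x,y)\in S_j$, and $\pi P^{[j]}=\pi$. Systematic scan Glauber dynamics is the Markov chain on $\Omega^+$ with transition matrix $P_{\to}=P^{[1]}P^{[2]}\cdots P^{[n]}$ (one transition is one complete scan). Dependency matrix: let $\mu_j(x,c)=P^{[j]}(x,x\to^j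 c)$, let $d_{\mathrm{TV}}$ be total variation distance, and let $\hat\varrho_{ij}=\max_{(x,y)\in S_i}d_{\mathrm{TV}}(\mu_j(x,\cdot),\mu_j(y,\cdot))$ be the influence of site $i$ on site $j$. A dependency matrix is any $n\times n$ matrix $R=(\varrho_{ij})$ with $\varrho_{ij}\ge\hat\varrho_{ij}$ for all $i,j$. Mixing time: $\tau(\varepsilon)$ is the least $t$ such that $d_{\mathrm{TV}}(x_t,\pi)\le\varepsilon$ for every initial configuration $x_0$, where $x_t$ is the (random) state after $t$ transitions. An asymptotic bound $\hat\tau(\varepsilon)$ is a quantity with $\limsup_{n\to\infty}\tau(\varepsilon)/\hat\tau(\varepsilon)\le1$. $\lambda(R)$ is the largest eigenvalue (spectral radius) of the nonnegative matrix $R$, and $\|R\|_2$ is the spectral norm; the two are equal for symmetric nonnegative $R$. *)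

theory Defs
  imports
    "HOL-Probability.Probability_Mass_Function"
    "Jordan_Normal_Form.Spectral_Radius"
begin

text \<open>
  The sites are \<open>{0..<n}\<close> and the spins \<open>{0..<q}\<close> instead of \<open>{1..n}\<close> and \<open>{1..q}\<close>, in line with
  the index range of \<^typ>\<open>real mat\<close>. Configurations are extensional functions, so there are exactly
  \<open>q ^ n\<close> of them and updating a site stays within the set.
\<close>

type_synonym config = "nat \<Rightarrow> nat"

definition configs :: "nat \<Rightarrow> nat \<Rightarrow> config set" where
  "configs n q = {0..<n} \<rightarrow>\<^sub>E {0..<q}"

definition site_pairs :: "nat \<Rightarrow> nat \<Rightarrow> nat \<Rightarrow> (config \<times> config) set" where
  "site_pairs n q j =
     {(x, y). x \<in> configs n q \<and> y \<in> configs n q \<and> (\<forall>i<n. i \<noteq> j \<longrightarrow> x i = y i)}"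

definition tv_dist :: "'a set \<Rightarrow> ('a \<Rightarrow> real) \<Rightarrow> ('a \<Rightarrow> real) \<Rightarrow> real" where
  "tv_dist A f g = (\<Sum>a\<in>A. \<bar>f a - g a\<bar>) / 2"

text \<open>
  A transition matrix is represented by its rows: \<open>pmf (K x) y\<close> is the entry at \<open>(x, y)\<close>, and
  \<open>bind_pmf \<nu> K\<close> is the row vector \<open>\<nu> K\<close>. Rows outside the configuration space play no role.
\<close>

type_synonym kernel = "config \<Rightarrow> config pmf"

definition kernel_mult :: "kernel \<Rightarrow> kernel \<Rightarrow> kernel" where
  "kernel_mult K L = (\<lambda>x. bind_pmf (K x) L)"

primrec kernel_power :: "kernel \<Rightarrow> nat \<Rightarrow> kernel" where
  "kernel_power K 0 = return_pmf"
| "kernel_power K (Suc t) = kernel_mult (kernel_power K t) K"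

definition spin_system ::
    "nat \<Rightarrow> nat \<Rightarrow> config pmf \<Rightarrow> (nat \<Rightarrow> kernel) \<Rightarrow> bool" where
  "spin_system n q \<pi> P \<longleftrightarrow>
     set_pmf \<pi> \<subseteq> configs n q \<and>
     (\<forall>j<n. \<forall>x\<in>configs n q. \<forall>y. pmf (P j x) y > 0 \<longrightarrow> (x, y) \<in> site_pairs n q j) \<and>
     (\<forall>j<n. bind_pmf \<pi> (P j) = \<pi>)"

text \<open>The product \<open>P 0 * P 1 * \<dots> * P (n - 1)\<close>, so site \<open>0\<close> is updated first.\<close>

definition scan_kernel :: "nat \<Rightarrow> (nat \<Rightarrow> kernel) \<Rightarrow> kernel" where
  "scan_kernel n P = foldr (\<lambda>j. kernel_mult (P j)) [0..<n] return_pmf"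

definition site_dist :: "(nat \<Rightarrow> kernel) \<Rightarrow> nat \<Rightarrow> config \<Rightarrow> nat \<Rightarrow> real" where
  "site_dist P j x c = pmf (P j x) (x(j := c))"

definition influence :: "nat \<Rightarrow> nat \<Rightarrow> (nat \<Rightarrow> kernel) \<Rightarrow> nat \<Rightarrow> nat \<Rightarrow> real" where
  "influence n q P i j =
     (MAX (x, y) \<in> site_pairs n q i. tv_dist {0..<q} (site_dist P j x) (site_dist P j y))"

definition dependency_matrix :: "nat \<Rightarrow> nat \<Rightarrow> (nat \<Rightarrow> kernel) \<Rightarrow> real mat \<Rightarrow> bool" where
  "dependency_matrix n q P R \<longleftrightarrow>
     R \<in> carrier_mat n n \<and> (\<forall>i<n. \<forall>j<n. influence n q P i j \<le> R $$ (i, j))"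

text \<open>The least such \<open>t\<close>, and \<open>\<infinity>\<close> if there is none.\<close>

definition mixing_time :: "config set \<Rightarrow> kernel \<Rightarrow> config pmf \<Rightarrow> real \<Rightarrow> enat" where
  "mixing_time \<Omega> K \<pi> \<epsilon> =
     (INF t \<in> {t. \<forall>x\<in>\<Omega>. tv_dist \<Omega> (pmf (kernel_power K t x)) (pmf \<pi>) \<le> \<epsilon>}. enat t)"

definition spectral_norm :: "real mat \<Rightarrow> real" where
  "spectral_norm A =
     (SUP v \<in> {v \<in> carrier_vec (dim_col A). v \<bullet> v = 1}. sqrt ((A *\<^sub>v v) \<bullet> (A *\<^sub>v v)))"

end

theory Submission
  imports Defs
begin

text \<open>
  The proof bounds oscillations of test functions. Let \<open>u i\<close> bound the variation of \<open>f\<close> over pairs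
  of configurations that differ at most at site \<open>i\<close>. Applying the kernel of site \<open>j\<close> to \<open>f\<close> replaces
  \<open>u i\<close> by \<open>u i + R i j * u j\<close> for \<open>i \<noteq> j\<close>, and \<open>u j\<close> by \<open>0\<close> (\<open>osc_bound_site_update\<close>). The total
  variation distance to \<open>\<pi>\<close> after \<open>t\<close> scans is at most the sum of the bounds that this yields for an
  indicator function, since \<open>\<pi>\<close> is stationary (\<open>tv_dist_scan_power\<close>).

  A scan thus acts on the vector of bounds by the Gauss-Seidel matrix
  \<open>L (I - U)\<^sup>-\<^sup>1\<close>, where \<open>R = L + U\<close> is the splitting into strictly lower and upper triangular parts. To
  contract by a factor \<open>s\<close> it suffices to have \<open>v \<ge> 0\<close> with \<open>L v \<le> s (I - U) v\<close>, the bounds then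
  being measured relative to \<open>w = (I - U) v\<close> (\<open>osc_bound_scan\<close>). As \<open>R\<close> is symmetric, the quadratic
  form of \<open>L + s U\<close> is \<open>(1 + s) / 2\<close> times that of \<open>R\<close>, hence at most \<open>(1 + s) * lam / 2\<close> times the
  squared length. If \<open>c = s - (1 + s) * lam / 2\<close> is positive, then \<open>s I - L - s U\<close> is therefore an
  M-matrix, and the solution \<open>v\<close> of \<open>(s I - L - s U) v = 1\<close> is nonnegative and has sum at most
  \<open>n / c\<close> (\<open>scan_weights\<close>). This gives the bound \<open>s ^ (t + 1) * n / c\<close> on the distance after \<open>t\<close>
  scans (\<open>tv_dist_scan_geometric\<close>).

  The condition \<open>c > 0\<close> says \<open>s > lam / (2 - lam)\<close>, and \<open>1 - lam / (2 - lam)\<close> equals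
  \<open>(1 - lam) / (1 - lam / 2)\<close>. Choosing \<open>1 - s\<close> as \<open>1 - d\<close> times this makes \<open>c = d * (1 - lam)\<close>, so that
  about \<open>(1 - lam / 2) / (1 - lam) * ln (n / (d * (1 - lam) * \<epsilon>)) / (1 - d)\<close> scans suffice
  (\<open>mixing_time_scan_le\<close>). For fixed \<open>d\<close> the term \<open>ln (1 / d)\<close> is negligible as \<open>n\<close> grows, which
  bounds the upper limit by \<open>1 / (1 - d)\<close>; finally \<open>d\<close> tends to \<open>0\<close>.
\<close>

\<comment> \<open>Below, \<open>\<bullet>\<close> and \<open>$\<close> refer to vectors of variable dimension.\<close>
unbundle no inner_syntax and no vec_syntax

section \<open>Weights from the spectral norm\<close>

lemma positive_definite_solvable:
  fixes a :: "nat \<Rightarrow> nat \<Rightarrow> real" and b :: "nat \<Rightarrow> real"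
  assumes pos: "\<And>x i. i < n \<Longrightarrow> x i \<noteq> 0 \<Longrightarrow> 0 < (\<Sum>i<n. x i * (\<Sum>j<n. a i j * x j))"
  obtains v where "\<And>i. i < n \<Longrightarrow> (\<Sum>j<n. a i j * v j) = b i"
proof -
  define A where "A = mat n n (\<lambda>(i, j). a i j)"
  have A: "A \<in> carrier_mat n n" by (simp add: A_def)
  have mult: "(A *\<^sub>v x) $ i = (\<Sum>j<n. a i j * x $ j)" if "i < n" "x \<in> carrier_vec n" for i x
    using that by (simp add: A_def scalar_prod_def lessThan_atLeast0)
  have "det A \<noteq> 0"
  proof
    assume "det A = 0"
    then obtain x where x: "x \<in> carrier_vec n" "x \<noteq> 0\<^sub>v n" "A *\<^sub>v x = 0\<^sub>v n"
      using det_0_iff_vec_prod_zero[OF A] by auto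
    then obtain i where i: "i < n" "x $ i \<noteq> 0"
      by (metis carrier_vecD eq_vecI index_zero_vec)
    have "(\<Sum>i<n. x $ i * (\<Sum>j<n. a i j * x $ j)) = 0"
      using x mult by (intro sum.neutral) (metis index_zero_vec(1) lessThan_iff mult_zero_right)
    with pos[of i "\<lambda>i. x $ i"] i show False by simp
  qed
  from det_non_zero_imp_unit[OF A this, of "()"]
  obtain B where B: "B \<in> carrier_mat n n" "A * B = 1\<^sub>m n"
    unfolding Units_def ring_mat_def by auto
  have "A *\<^sub>v (B *\<^sub>v vec n b) = vec n b"
    using A B by (metis assoc_mult_mat_vec one_mult_mat_vec vec_carrier)
  then have "(\<Sum>j<n. a i j * (B *\<^sub>v vec n b) $ j) = b i" if "i < n" for i
    using mult[OF that, of "B *\<^sub>v vec n b"] B that by (metis index_vec mult_mat_vec_carrier vec_carrier)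
  then show thesis by (rule that)
qed

text \<open>
  The M-matrix property of \<open>s I - m\<close>: a nonnegative matrix \<open>m\<close> whose quadratic form stays below \<open>s\<close>
  by the margin \<open>c\<close> gives a nonnegative solution of \<open>(s I - m) v = 1\<close>. No symmetry is needed.
\<close>

lemma nonneg_resolvent:
  fixes m :: "nat \<Rightarrow> nat \<Rightarrow> real"
  assumes m: "\<And>i j. i < n \<Longrightarrow> j < n \<Longrightarrow> 0 \<le> m i j"
    and form: "\<And>x. (\<Sum>i<n. \<Sum>j<n. m i j * x i * x j) \<le> (s - c) * (\<Sum>i<n. (x i)\<^sup>2)"
    and c: "0 < c"
  obtains v where "\<And>i. i < n \<Longrightarrow> 0 \<le> v i"
    and "\<And>i. i < n \<Longrightarrow> s * v i = 1 + (\<Sum>j<n. m i j * v j)"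
    and "(\<Sum>i<n. v i) \<le> real n / c"
proof -
  define a where "a i j = (if i = j then s else 0) - m i j" for i j
  have a: "(\<Sum>j<n. a i j * x j) = s * x i - (\<Sum>j<n. m i j * x j)" if "i < n" for i x
  proof -
    have "(\<Sum>j<n. a i j * x j) = (\<Sum>j<n. (if i = j then s * x j else 0) - m i j * x j)"
      by (intro sum.cong) (auto simp: a_def algebra_simps)
    also have "\<dots> = s * x i - (\<Sum>j<n. m i j * x j)"
      using that by (simp add: sum_subtractf)
    finally show ?thesis .
  qed
  have coercive: "c * (\<Sum>i<n. (x i)\<^sup>2) \<le> (\<Sum>i<n. x i * (\<Sum>j<n. a i j * x j))" for x
  proof -
    have "(\<Sum>i<n. x i * (\<Sum>j<n. a i j * x j)) =
        (\<Sum>i<n. s * (x i)\<^sup>2 - (\<Sum>j<n. m i j * x i * x j))"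
    proof (intro sum.cong refl)
      fix i assume "i \<in> {..<n}"
      then have "(\<Sum>j<n. a i j * x j) = s * x i - (\<Sum>j<n. m i j * x j)" by (simp add: a)
      then have "x i * (\<Sum>j<n. a i j * x j) = s * (x i)\<^sup>2 - x i * (\<Sum>j<n. m i j * x j)"
        by (simp add: right_diff_distrib power2_eq_square mult_ac)
      then show "x i * (\<Sum>j<n. a i j * x j) = s * (x i)\<^sup>2 - (\<Sum>j<n. m i j * x i * x j)"
        by (simp add: sum_distrib_left mult_ac)
    qed
    also have "\<dots> = s * (\<Sum>i<n. (x i)\<^sup>2) - (\<Sum>i<n. \<Sum>j<n. m i j * x i * x j)"
      by (simp add: sum_subtractf sum_distrib_left)
    finally show ?thesis using form[of x] by (simp add: algebra_simps)
  qed
  have pos: "0 < (\<Sum>i<n. x i * (\<Sum>j<n. a i j * x j))" if "i < n" "x i \<noteq> 0" for x i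
  proof -
    have "0 < (\<Sum>i<n. (x i)\<^sup>2)"
      using that by (intro sum_pos2[of _ i]) auto
    with c coercive[of x] show ?thesis by (meson less_le_trans mult_pos_pos)
  qed
  obtain v where v: "\<And>i. i < n \<Longrightarrow> (\<Sum>j<n. a i j * v j) = 1"
  proof (rule positive_definite_solvable[of n a "\<lambda>_. 1"])
    fix x :: "nat \<Rightarrow> real" and i
    assume "i < n" "x i \<noteq> 0"
    then show "0 < (\<Sum>i<n. x i * (\<Sum>j<n. a i j * x j))" by (rule pos)
  qed blast
  have eq: "s * v i = 1 + (\<Sum>j<n. m i j * v j)" if "i < n" for i
    using v[OF that] a[OF that, of v] by simp
  have nonneg: "0 \<le> v i" if "i < n" for i
  proof (rule ccontr)
    assume neg: "\<not> 0 \<le> v i"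
    \<comment> \<open>The negative part \<open>x\<close> of \<open>v\<close> violates positive definiteness unless it vanishes.\<close>
    define x where "x k = max 0 (- v k)" for k
    have "x k * (\<Sum>j<n. a k j * x j) \<le> - x k" if k: "k < n" for k
    proof (cases "v k < 0")
      case True
      have "(\<Sum>j<n. m k j * - v j) \<le> (\<Sum>j<n. m k j * x j)"
        using k by (intro sum_mono mult_left_mono m) (auto simp: x_def)
      then have "- (\<Sum>j<n. m k j * v j) \<le> (\<Sum>j<n. m k j * x j)"
        by (simp add: sum_negf)
      then have "(\<Sum>j<n. a k j * x j) \<le> - 1"
        using eq[OF k] a[OF k, of x] True by (simp add: x_def)
      then show ?thesis using mult_left_mono[of _ "-1" "x k"] by (simp add: x_def)
    qed (simp add: x_def)
    then have "(\<Sum>k<n. x k * (\<Sum>j<n. a k j * x j)) \<le> (\<Sum>k<n. - x k)"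
      by (intro sum_mono) auto
    also have "\<dots> \<le> 0" by (intro sum_nonpos) (auto simp: x_def)
    finally show False using pos[of i x] that neg by (simp add: x_def)
  qed
  have "(\<Sum>i<n. v i) \<le> real n / c"
  proof (cases "(\<Sum>i<n. v i) = 0")
    case False
    moreover have "0 \<le> (\<Sum>i<n. v i)" using nonneg by (intro sum_nonneg) auto
    ultimately have S: "0 < (\<Sum>i<n. v i)" by simp
    have "c * (\<Sum>i<n. (v i)\<^sup>2) \<le> (\<Sum>i<n. v i)"
      using coercive[of v] v by simp
    moreover have "(\<Sum>i<n. v i)\<^sup>2 \<le> real n * (\<Sum>i<n. (v i)\<^sup>2)"
      using Cauchy_Schwarz_ineq_sum[of "\<lambda>_. 1" v "{..<n}"] by simp
    ultimately have "c * (\<Sum>i<n. v i)\<^sup>2 \<le> real n * (\<Sum>i<n. v i)"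
      using c by (smt (verit) mult.left_commute mult_left_mono of_nat_0_le_iff)
    with S c show ?thesis by (simp add: power2_eq_square field_simps)
  qed (use c in simp)
  with nonneg eq show thesis by (rule that)
qed

text \<open>
  The real supremum in the definition of the spectral norm is only meaningful for a set that is
  bounded above, which is part of the proof.
\<close>

lemma spectral_norm_bound:
  assumes A: "A \<in> carrier_mat n n" and v: "v \<in> carrier_vec n"
  shows "sqrt ((A *\<^sub>v v) \<bullet> (A *\<^sub>v v)) \<le> spectral_norm A * sqrt (v \<bullet> v)"
proof -
  let ?S = "{v \<in> carrier_vec (dim_col A). v \<bullet> v = 1}"
  let ?f = "\<lambda>v. sqrt ((A *\<^sub>v v) \<bullet> (A *\<^sub>v v))"
  define B where "B = (\<Sum>i<n. (\<Sum>j<n. \<bar>A $$ (i, j)\<bar>)\<^sup>2)"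
  have bound: "?f u \<le> sqrt B" if u: "u \<in> carrier_vec n" "u \<bullet> u = 1" for u
  proof -
    have entry: "\<bar>u $ j\<bar> \<le> 1" if "j < n" for j
    proof -
      have "(u $ j)\<^sup>2 \<le> (\<Sum>j<n. (u $ j)\<^sup>2)"
        using that by (intro member_le_sum) auto
      also have "\<dots> = 1" using u by (simp add: scalar_prod_def lessThan_atLeast0 power2_eq_square)
      finally show ?thesis using abs_square_le_1 by blast
    qed
    have "(A *\<^sub>v u) \<bullet> (A *\<^sub>v u) = (\<Sum>i<n. (\<Sum>j<n. A $$ (i, j) * u $ j)\<^sup>2)"
      using A u by (auto simp: scalar_prod_def lessThan_atLeast0 power2_eq_square intro!: sum.cong)
    also have "\<dots> \<le> B"
      unfolding B_def
    proof (intro sum_mono)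
      fix i
      have "\<bar>\<Sum>j<n. A $$ (i, j) * u $ j\<bar> \<le> (\<Sum>j<n. \<bar>A $$ (i, j)\<bar>)"
        using entry by (intro order_trans[OF sum_abs] sum_mono) (auto simp: abs_mult mult_left_le)
      then show "(\<Sum>j<n. A $$ (i, j) * u $ j)\<^sup>2 \<le> (\<Sum>j<n. \<bar>A $$ (i, j)\<bar>)\<^sup>2"
        using power_mono[of "\<bar>\<Sum>j<n. A $$ (i, j) * u $ j\<bar>" _ 2] by simp
    qed
    finally show ?thesis by simp
  qed
  then have bdd: "bdd_above (?f ` ?S)"
    using A by (auto intro!: bdd_aboveI[of _ "sqrt B"] simp del: real_sqrt_le_iff)
  show ?thesis
  proof (cases "v \<bullet> v = 0")
    case True
    then have "v = 0\<^sub>v n"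
      using v by (intro eq_vecI) (auto simp: scalar_prod_def sum_nonneg_eq_0_iff)
    then have "A *\<^sub>v v = 0\<^sub>v n" using A by auto
    then show ?thesis using True by simp
  next
    case False
    have "0 \<le> v \<bullet> v" unfolding scalar_prod_def by (intro sum_nonneg) auto
    with False have pos: "0 < v \<bullet> v" by simp
    define t where "t = 1 / sqrt (v \<bullet> v)"
    have t: "0 < t" "t\<^sup>2 * (v \<bullet> v) = 1" using pos by (auto simp: t_def power_divide)
    have "t \<cdot>\<^sub>v v \<in> ?S"
      using A v t by (auto simp: power2_eq_square)
    then have "?f (t \<cdot>\<^sub>v v) \<le> spectral_norm A"
      unfolding spectral_norm_def by (intro cSUP_upper bdd)
    moreover have "?f (t \<cdot>\<^sub>v v) = t * ?f v"
    proof -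
      have Av: "A *\<^sub>v v \<in> carrier_vec n" using A v by auto
      have "(A *\<^sub>v (t \<cdot>\<^sub>v v)) \<bullet> (A *\<^sub>v (t \<cdot>\<^sub>v v)) = t\<^sup>2 * ((A *\<^sub>v v) \<bullet> (A *\<^sub>v v))"
        using Av mult_mat_vec[OF A v] by (simp add: power2_eq_square)
      then show ?thesis using t by (simp add: real_sqrt_mult)
    qed
    moreover have "t * ?f v \<le> spectral_norm A \<longleftrightarrow> ?f v \<le> spectral_norm A * sqrt (v \<bullet> v)"
      using pos unfolding t_def by (simp add: pos_divide_le_eq del: mult_mat_vec)
    ultimately show ?thesis by simp
  qed
qed

lemma spectral_norm_nonneg:
  assumes A: "A \<in> carrier_mat n n" and n: "n \<ge> 1"
  shows "0 \<le> spectral_norm A"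
proof -
  have "0 \<le> sqrt ((A *\<^sub>v unit_vec n 0) \<bullet> (A *\<^sub>v unit_vec n 0))"
    unfolding scalar_prod_def by (intro real_sqrt_ge_zero sum_nonneg) auto
  also have "\<dots> \<le> spectral_norm A"
    using spectral_norm_bound[OF A, of "unit_vec n 0"] n by simp
  finally show ?thesis .
qed

lemma spectral_norm_quadratic_form:
  assumes A: "A \<in> carrier_mat n n"
  shows "(\<Sum>i<n. \<Sum>j<n. A $$ (i, j) * x i * x j) \<le> spectral_norm A * (\<Sum>i<n. (x i)\<^sup>2)"
proof -
  define v where "v = vec n x"
  have v: "v \<in> carrier_vec n" by (simp add: v_def)
  have vv: "v \<bullet> v = (\<Sum>i<n. (x i)\<^sup>2)"
    by (simp add: v_def scalar_prod_def lessThan_atLeast0 power2_eq_square)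
  have Av: "(A *\<^sub>v v) $ i = (\<Sum>j<n. A $$ (i, j) * x j)" if "i < n" for i
    using A that by (auto simp: v_def scalar_prod_def lessThan_atLeast0 intro!: sum.cong)
  have AvAv: "(A *\<^sub>v v) \<bullet> (A *\<^sub>v v) = (\<Sum>i<n. ((A *\<^sub>v v) $ i)\<^sup>2)"
    using A by (simp add: scalar_prod_def lessThan_atLeast0 power2_eq_square)
  have "(\<Sum>i<n. \<Sum>j<n. A $$ (i, j) * x i * x j) = (\<Sum>i<n. x i * (A *\<^sub>v v) $ i)"
    by (intro sum.cong) (auto simp: Av sum_distrib_left mult_ac)
  also have "\<dots> \<le> sqrt ((\<Sum>i<n. (x i)\<^sup>2) * (\<Sum>i<n. ((A *\<^sub>v v) $ i)\<^sup>2))"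
    by (intro real_le_rsqrt Cauchy_Schwarz_ineq_sum)
  also have "\<dots> = sqrt (v \<bullet> v) * sqrt ((A *\<^sub>v v) \<bullet> (A *\<^sub>v v))"
    by (simp add: vv AvAv real_sqrt_mult)
  also have "\<dots> \<le> sqrt (v \<bullet> v) * (spectral_norm A * sqrt (v \<bullet> v))"
    by (intro mult_left_mono spectral_norm_bound[OF A v]) (simp add: vv sum_nonneg)
  also have "\<dots> = spectral_norm A * (\<Sum>i<n. (x i)\<^sup>2)"
    by (simp add: vv sum_nonneg)
  finally show ?thesis .
qed

text \<open>
  The equation reads \<open>s (I - U) v = 1 + L v\<close> for the strictly lower and upper triangular parts \<open>L\<close>
  and \<open>U\<close> of \<open>r\<close>; in particular \<open>L v \<le> s (I - U) v\<close>.
\<close>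

lemma scan_weights:
  fixes r :: "nat \<Rightarrow> nat \<Rightarrow> real"
  assumes r: "\<And>i j. i < n \<Longrightarrow> j < n \<Longrightarrow> 0 \<le> r i j"
    and sym: "\<And>i j. i < n \<Longrightarrow> j < n \<Longrightarrow> r i j = r j i"
    and diag: "\<And>i. i < n \<Longrightarrow> r i i = 0"
    and form: "\<And>x. (\<Sum>i<n. \<Sum>j<n. r i j * x i * x j) \<le> lam * (\<Sum>i<n. (x i)\<^sup>2)"
    and s: "0 \<le> s" and c: "0 < c" "(1 + s) * lam / 2 \<le> s - c"
  obtains v where "\<And>i. i < n \<Longrightarrow> 0 \<le> v i"
    and "\<And>i. i < n \<Longrightarrow> s * (v i - (\<Sum>k\<in>{i<..<n}. r i k * v k)) = 1 + (\<Sum>k<i. r i k * v k)"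
    and "(\<Sum>i<n. v i) \<le> real n / c"
proof -
  define m where "m i j = (if j < i then r i j else s * r i j)" for i j
  have form_m: "(\<Sum>i<n. \<Sum>j<n. m i j * x i * x j) \<le> (s - c) * (\<Sum>i<n. (x i)\<^sup>2)" for x
  proof -
    \<comment> \<open>Only the symmetric part \<open>(1 + s) / 2 * r\<close> of \<open>m\<close> contributes to the quadratic form.\<close>
    have "2 * (\<Sum>i<n. \<Sum>j<n. m i j * x i * x j) =
        (\<Sum>i<n. \<Sum>j<n. m i j * x i * x j) + (\<Sum>j<n. \<Sum>i<n. m i j * x i * x j)"
      using sum.swap[of "\<lambda>i j. m i j * x i * x j" "{..<n}" "{..<n}"] by simp
    also have "\<dots> = (\<Sum>i<n. \<Sum>j<n. (m i j + m j i) * x i * x j)"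
      by (simp add: sum.distrib algebra_simps)
    also have "\<dots> = (\<Sum>i<n. \<Sum>j<n. (1 + s) * (r i j * x i * x j))"
    proof (intro sum.cong refl)
      fix i j assume ij: "i \<in> {..<n}" "j \<in> {..<n}"
      then have "m i j + m j i = (1 + s) * r i j"
        using sym[of i j] diag[of i] by (cases i j rule: linorder_cases) (auto simp: m_def algebra_simps)
      then show "(m i j + m j i) * x i * x j = (1 + s) * (r i j * x i * x j)" by simp
    qed
    also have "\<dots> = (1 + s) * (\<Sum>i<n. \<Sum>j<n. r i j * x i * x j)"
      by (simp add: sum_distrib_left)
    also have "\<dots> \<le> (1 + s) * (lam * (\<Sum>i<n. (x i)\<^sup>2))"
      using s by (intro mult_left_mono form) simp
    finally have "(\<Sum>i<n. \<Sum>j<n. m i j * x i * x j) \<le> (1 + s) * lam / 2 * (\<Sum>i<n. (x i)\<^sup>2)"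
      by (simp add: mult_ac)
    also have "\<dots> \<le> (s - c) * (\<Sum>i<n. (x i)\<^sup>2)"
      using c by (intro mult_right_mono sum_nonneg) auto
    finally show ?thesis .
  qed
  have m_nonneg: "0 \<le> m i j" if "i < n" "j < n" for i j
    using r[OF that] s by (simp add: m_def)
  obtain v where v: "\<And>i. i < n \<Longrightarrow> 0 \<le> v i"
      "\<And>i. i < n \<Longrightarrow> s * v i = 1 + (\<Sum>j<n. m i j * v j)" "(\<Sum>i<n. v i) \<le> real n / c"
    using nonneg_resolvent[OF m_nonneg form_m c(1)] by blast
  have "s * (v i - (\<Sum>k\<in>{i<..<n}. r i k * v k)) = 1 + (\<Sum>k<i. r i k * v k)" if i: "i < n" for i
  proof -
    have "(\<Sum>j<n. m i j * v j) = (\<Sum>j\<in>{..<i} \<union> insert i {i<..<n}. m i j * v j)"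
      using i by (intro sum.cong) auto
    also have "\<dots> = (\<Sum>j<i. m i j * v j) + (\<Sum>j\<in>insert i {i<..<n}. m i j * v j)"
      by (rule sum.union_disjoint) auto
    also have "\<dots> = (\<Sum>j<i. r i j * v j) + s * (\<Sum>j\<in>{i<..<n}. r i j * v j)"
      using diag[OF i] by (simp add: m_def sum_distrib_left mult_ac)
    finally show ?thesis using v(2)[OF i] by (simp add: algebra_simps)
  qed
  with v(1) show thesis using v(3) by (rule that)
qed

section \<open>Oscillations of functions on configurations\<close>

lemma finite_configs: "finite (configs n q)"
  by (simp add: configs_def finite_PiE)

lemma finite_site_pairs: "finite (site_pairs n q j)"
  by (rule finite_subset[OF _ finite_cartesian_product[OF finite_configs finite_configs]])
    (auto simp: site_pairs_def)

text \<open>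
  \<open>u i\<close> bounds the variation of \<open>f\<close> under changes of the spin at site \<open>i\<close>. No absolute value is
  needed because the set of pairs is symmetric.
\<close>

definition osc_bound :: "nat \<Rightarrow> nat \<Rightarrow> (config \<Rightarrow> real) \<Rightarrow> (nat \<Rightarrow> real) \<Rightarrow> bool" where
  "osc_bound n q f u \<longleftrightarrow> (\<forall>i<n. \<forall>(x, y)\<in>site_pairs n q i. f x - f y \<le> u i)"

text \<open>The action \<open>K f\<close> of a transition matrix \<open>K\<close> on a function \<open>f\<close>, seen as a column vector.\<close>

definition apply_kernel :: "kernel \<Rightarrow> (config \<Rightarrow> real) \<Rightarrow> config \<Rightarrow> real" where
  "apply_kernel K f x = measure_pmf.expectation (K x) f"

lemma sum_difference_le_tv_dist:
  fixes p p' g :: "'a \<Rightarrow> real"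
  assumes C: "finite C" and eq: "sum p C = sum p' C"
    and D: "\<And>c d. c \<in> C \<Longrightarrow> d \<in> C \<Longrightarrow> g c - g d \<le> D"
  shows "(\<Sum>c\<in>C. (p c - p' c) * g c) \<le> tv_dist C p p' * D"
proof (cases "C = {}")
  case False
  define m where "m = Min (g ` C)"
  have m: "m \<le> g c" "g c - m \<le> D" if "c \<in> C" for c
  proof -
    show "m \<le> g c" using C that by (simp add: m_def)
    have "m \<in> g ` C" unfolding m_def using C False by (intro Min_in) auto
    then show "g c - m \<le> D" using D that by auto
  qed
  \<comment> \<open>As \<open>p\<close> and \<open>p'\<close> have the same mass, \<open>g\<close> may be shifted to take values in \<open>[-D/2, D/2]\<close>.\<close>
  have "(\<Sum>c\<in>C. (p c - p' c) * (m + D / 2)) = 0"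
    using eq by (simp add: sum_subtractf flip: sum_distrib_right)
  then have "(\<Sum>c\<in>C. (p c - p' c) * g c) = (\<Sum>c\<in>C. (p c - p' c) * (g c - (m + D / 2)))"
    by (simp add: right_diff_distrib sum_subtractf)
  also have "\<dots> \<le> (\<Sum>c\<in>C. \<bar>p c - p' c\<bar> * (D / 2))"
  proof (intro sum_mono)
    fix c assume "c \<in> C"
    with m[of c] have "\<bar>g c - (m + D / 2)\<bar> \<le> D / 2"
      by (intro abs_leI) (simp_all add: field_simps)
    then have "\<bar>p c - p' c\<bar> * \<bar>g c - (m + D / 2)\<bar> \<le> \<bar>p c - p' c\<bar> * (D / 2)"
      by (rule mult_left_mono) simp
    then show "(p c - p' c) * (g c - (m + D / 2)) \<le> \<bar>p c - p' c\<bar> * (D / 2)"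
      unfolding abs_mult[symmetric] by (rule order_trans[OF abs_ge_self])
  qed
  also have "\<dots> = tv_dist C p p' * D"
    by (simp add: tv_dist_def sum_distrib_right)
  finally show ?thesis .
qed (simp add: tv_dist_def)

lemma fun_upd_configs: "x \<in> configs n q \<Longrightarrow> j < n \<Longrightarrow> c < q \<Longrightarrow> x(j := c) \<in> configs n q"
  by (auto simp: configs_def PiE_iff extensional_def)

lemma site_pairs_fun_upd:
  assumes "(x, y) \<in> site_pairs n q j" "j < n"
  shows "y = x(j := y j)" "y j < q"
proof -
  from assms have xy: "x \<in> configs n q" "y \<in> configs n q" "\<And>i. i < n \<Longrightarrow> i \<noteq> j \<Longrightarrow> x i = y i"
    by (auto simp: site_pairs_def)
  show "y = x(j := y j)"
  proof
    fix i
    show "y i = (x(j := y j)) i"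
      using xy by (cases "i < n") (auto simp: configs_def PiE_iff extensional_def)
  qed
  show "y j < q" using xy assms by (auto simp: configs_def PiE_iff)
qed

lemma apply_kernel_site:
  assumes sys: "spin_system n q \<pi> P" and j: "j < n" and x: "x \<in> configs n q"
  shows "apply_kernel (P j) f x = (\<Sum>c\<in>{0..<q}. site_dist P j x c * f (x(j := c)))"
proof -
  have inj: "inj_on (\<lambda>c. x(j := c)) {0..<q}"
    by (rule inj_onI) (metis fun_upd_same)
  have "apply_kernel (P j) f x = (\<Sum>y\<in>(\<lambda>c. x(j := c)) ` {0..<q}. f y * pmf (P j x) y)"
    unfolding apply_kernel_def
  proof (rule integral_measure_pmf_real)
    fix y assume "y \<in> set_pmf (P j x)"
    then have "0 < pmf (P j x) y" by (rule pmf_positive)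
    then have "(x, y) \<in> site_pairs n q j"
      using sys j x by (simp add: spin_system_def)
    from site_pairs_fun_upd[OF this j] show "y \<in> (\<lambda>c. x(j := c)) ` {0..<q}" by auto
  qed simp
  then show ?thesis
    by (simp add: sum.reindex[OF inj] site_dist_def mult.commute)
qed

lemma sum_site_dist:
  assumes "spin_system n q \<pi> P" "j < n" "x \<in> configs n q"
  shows "(\<Sum>c\<in>{0..<q}. site_dist P j x c) = 1"
  using apply_kernel_site[OF assms, of "\<lambda>_. 1"] by (simp add: apply_kernel_def)

lemma influence_upper:
  "(x, y) \<in> site_pairs n q i \<Longrightarrow>
    tv_dist {0..<q} (site_dist P j x) (site_dist P j y) \<le> influence n q P i j"
  unfolding influence_def
  by (rule Max_ge) (simp add: finite_site_pairs, rule image_eqI[of _ _ "(x, y)"], simp_all)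

lemma configs_nonempty: "spin_system n q \<pi> P \<Longrightarrow> configs n q \<noteq> {}"
  using set_pmf_not_empty[of \<pi>] by (auto simp: spin_system_def)

lemma tv_dist_nonneg: "0 \<le> tv_dist A f g"
  by (simp add: tv_dist_def sum_nonneg)

lemma influence_nonneg:
  assumes "spin_system n q \<pi> P"
  shows "0 \<le> influence n q P i j"
proof -
  from configs_nonempty[OF assms] obtain x where "x \<in> configs n q" by auto
  then have "(x, x) \<in> site_pairs n q i" by (simp add: site_pairs_def)
  from influence_upper[OF this, of P j] tv_dist_nonneg show ?thesis
    by (meson order_trans)
qed

lemma dependency_matrix_nonneg:
  assumes "spin_system n q \<pi> P" "dependency_matrix n q P R" "i < n" "j < n"
  shows "0 \<le> R $$ (i, j)"
  using assms influence_nonneg[OF assms(1), of i j]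
  by (auto simp: dependency_matrix_def intro: order_trans)

text \<open>
  The change of \<open>P j f\<close> splits into the change of \<open>f\<close> under the same new spin, and the change of the
  distribution of the new spin. If \<open>i = j\<close>, the former vanishes trivially and the latter by the zero
  diagonal.
\<close>

lemma osc_bound_site_update:
  assumes sys: "spin_system n q \<pi> P" and dep: "dependency_matrix n q P R"
    and j: "j < n" and diag: "R $$ (j, j) = 0" and u: "osc_bound n q f u"
  shows "osc_bound n q (apply_kernel (P j) f) (\<lambda>i. if i = j then 0 else u i + R $$ (i, j) * u j)"
  unfolding osc_bound_def
proof (intro allI impI, clarify)
  fix i x y assume i: "i < n" and xy: "(x, y) \<in> site_pairs n q i"
  let ?p = "site_dist P j x" and ?p' = "site_dist P j y"
  have x: "x \<in> configs n q" and y: "y \<in> configs n q" using xy by (auto simp: site_pairs_def)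
  have osc: "f z - f z' \<le> u k" if "k < n" "(z, z') \<in> site_pairs n q k" for k z z'
    using u that by (auto simp: osc_bound_def)
  have "tv_dist {0..<q} ?p ?p' \<le> influence n q P i j" by (rule influence_upper[OF xy])
  also have "\<dots> \<le> R $$ (i, j)" using dep i j by (simp add: dependency_matrix_def)
  finally have tv: "tv_dist {0..<q} ?p ?p' \<le> R $$ (i, j)" .
  have D: "f (y(j := c)) - f (y(j := d)) \<le> u j" if "c \<in> {0..<q}" "d \<in> {0..<q}" for c d
    using that j y by (intro osc) (auto simp: site_pairs_def fun_upd_configs)
  have "(y, y) \<in> site_pairs n q j" using y by (simp add: site_pairs_def)
  from osc[OF j this] have uj: "0 \<le> u j" by simp
  have "(\<Sum>c\<in>{0..<q}. (?p c - ?p' c) * f (y(j := c))) \<le> tv_dist {0..<q} ?p ?p' * u j"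
    using D by (intro sum_difference_le_tv_dist) (simp_all add: sum_site_dist[OF sys j] x y)
  also have "\<dots> \<le> R $$ (i, j) * u j" using tv uj by (rule mult_right_mono)
  finally have kernel_part: "(\<Sum>c\<in>{0..<q}. (?p c - ?p' c) * f (y(j := c))) \<le> R $$ (i, j) * u j" .
  have "(\<Sum>c\<in>{0..<q}. ?p c * (f (x(j := c)) - f (y(j := c)))) \<le> (if i = j then 0 else u i)"
  proof (cases "i = j")
    case True
    then have "x(j := c) = y(j := c)" for c
      using site_pairs_fun_upd(1)[OF xy] j by (metis fun_upd_upd)
    then show ?thesis using True by simp
  next
    case False
    have "(\<Sum>c\<in>{0..<q}. ?p c * (f (x(j := c)) - f (y(j := c)))) \<le> (\<Sum>c\<in>{0..<q}. ?p c * u i)"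
    proof (intro sum_mono mult_left_mono)
      fix c assume "c \<in> {0..<q}"
      then show "f (x(j := c)) - f (y(j := c)) \<le> u i"
        using xy i j by (intro osc) (auto simp: site_pairs_def fun_upd_configs)
    qed (simp add: site_dist_def)
    also have "\<dots> = u i"
      using sum_site_dist[OF sys j x] by (simp flip: sum_distrib_right)
    finally show ?thesis using False by simp
  qed
  moreover have "apply_kernel (P j) f x - apply_kernel (P j) f y =
      (\<Sum>c\<in>{0..<q}. ?p c * (f (x(j := c)) - f (y(j := c)))) +
      (\<Sum>c\<in>{0..<q}. (?p c - ?p' c) * f (y(j := c)))"
    by (simp add: apply_kernel_site[OF sys j] x y algebra_simps
        flip: sum.distrib sum_subtractf)
  ultimately show "apply_kernel (P j) f x - apply_kernel (P j) f y
      \<le> (if i = j then 0 else u i + R $$ (i, j) * u j)"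
    using kernel_part diag by (auto split: if_splits)
qed

lemma osc_bound_telescope:
  assumes u: "osc_bound n q f u" and x: "x \<in> configs n q" and y: "y \<in> configs n q"
  shows "f x - f y \<le> (\<Sum>i<n. u i)"
proof -
  \<comment> \<open>Interpolate by the configurations that agree with \<open>y\<close> on the first \<open>k\<close> sites.\<close>
  define z where "z k = (\<lambda>i. if i < k then y i else x i)" for k
  have z: "z k \<in> configs n q" for k
    using x y by (auto simp: z_def configs_def PiE_iff extensional_def)
  have "f (z k) - f (z (Suc k)) \<le> u k" if "k < n" for k
    using u z that by (auto simp: osc_bound_def site_pairs_def z_def)
  then have "(\<Sum>k<n. f (z k) - f (z (Suc k))) \<le> (\<Sum>k<n. u k)"
    by (intro sum_mono) auto
  moreover have "(\<Sum>k<n. f (z k) - f (z (Suc k))) = f (z 0) - f (z n)"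
    by (rule sum_lessThan_telescope')
  moreover have "z 0 = x" by (simp add: z_def)
  moreover have "z n = y"
    using x y by (auto simp: z_def configs_def PiE_iff extensional_def fun_eq_iff)
  ultimately show ?thesis by simp
qed

section \<open>Contraction of oscillations under scans\<close>

lemma set_pmf_site:
  assumes "spin_system n q \<pi> P" "j < n" "x \<in> configs n q"
  shows "set_pmf (P j x) \<subseteq> configs n q"
proof
  fix y assume "y \<in> set_pmf (P j x)"
  then have "0 < pmf (P j x) y" by (rule pmf_positive)
  with assms have "(x, y) \<in> site_pairs n q j" by (simp add: spin_system_def)
  then show "y \<in> configs n q" by (simp add: site_pairs_def)
qed

lemma set_pmf_scan_suffix:
  assumes sys: "spin_system n q \<pi> P" and x: "x \<in> configs n q"
    and js: "set js \<subseteq> {..<n}"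
  shows "set_pmf (foldr (\<lambda>j. kernel_mult (P j)) js return_pmf x) \<subseteq> configs n q"
  using js x
proof (induction js arbitrary: x)
  case (Cons j js)
  have "set_pmf (P j x) \<subseteq> configs n q"
    using Cons.prems by (intro set_pmf_site[OF sys]) simp_all
  moreover have "set_pmf (foldr (\<lambda>j. kernel_mult (P j)) js return_pmf y) \<subseteq> configs n q"
    if "y \<in> configs n q" for y
    using Cons.IH[OF _ that] Cons.prems by simp
  ultimately show ?case
    unfolding foldr_Cons comp_apply kernel_mult_def set_bind_pmf by (intro UN_least) auto
qed simp

lemma set_pmf_scan:
  assumes "spin_system n q \<pi> P" "x \<in> configs n q"
  shows "set_pmf (scan_kernel n P x) \<subseteq> configs n q"
  unfolding scan_kernel_def using assms by (intro set_pmf_scan_suffix) auto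

lemma set_pmf_kernel_power:
  assumes "\<And>x. x \<in> \<Omega> \<Longrightarrow> set_pmf (K x) \<subseteq> \<Omega>" "x \<in> \<Omega>"
  shows "set_pmf (kernel_power K t x) \<subseteq> \<Omega>"
  using assms by (induction t) (auto simp: kernel_mult_def)

lemma apply_kernel_mult:
  assumes K: "set_pmf (K x) \<subseteq> \<Omega>" and L: "\<And>x. x \<in> \<Omega> \<Longrightarrow> set_pmf (L x) \<subseteq> \<Omega>" and \<Omega>: "finite \<Omega>"
  shows "apply_kernel (kernel_mult K L) f x = apply_kernel K (apply_kernel L f) x"
proof -
  have "apply_kernel (kernel_mult K L) f x = (\<Sum>a\<in>\<Omega>. pmf (K x) a *\<^sub>R apply_kernel L f a)"
    unfolding apply_kernel_def kernel_mult_def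
    using K L \<Omega> by (intro pmf_expectation_bind) (blast intro: finite_subset)+
  also have "\<dots> = apply_kernel K (apply_kernel L f) x"
    unfolding apply_kernel_def[of K] by (rule integral_measure_pmf[symmetric]) (use K \<Omega> in auto)
  finally show ?thesis .
qed

lemma osc_bound_cong:
  assumes "osc_bound n q f u" "\<And>x. x \<in> configs n q \<Longrightarrow> f x = g x" "\<And>i. i < n \<Longrightarrow> u i \<le> w i"
  shows "osc_bound n q g w"
  unfolding osc_bound_def
proof (intro allI impI, clarify)
  fix i x y assume "i < n" and "(x, y) \<in> site_pairs n q i"
  moreover from this have "f x - f y \<le> u i" "x \<in> configs n q" "y \<in> configs n q"
    using assms(1) by (auto simp: osc_bound_def site_pairs_def)
  ultimately show "g x - g y \<le> w i" using assms(2)[of x] assms(2)[of y] assms(3)[of i] by simp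
qed

text \<open>
  One scan takes the bounds \<open>k (I - U) v\<close> to \<open>k L v\<close>, for the strictly lower and upper triangular
  parts \<open>L\<close> and \<open>U\<close> of \<open>R\<close>.
\<close>

lemma osc_bound_scan:
  assumes sys: "spin_system n q \<pi> P" and dep: "dependency_matrix n q P R"
    and diag: "\<And>i. i < n \<Longrightarrow> R $$ (i, i) = 0"
    and f: "osc_bound n q f (\<lambda>i. k * (v i - (\<Sum>j\<in>{i<..<n}. R $$ (i, j) * v j)))"
  shows "osc_bound n q (apply_kernel (scan_kernel n P) f) (\<lambda>i. k * (\<Sum>j<i. R $$ (i, j) * v j))"
proof -
  \<comment> \<open>The product of kernels applies the last factor to \<open>f\<close> first, so that the sites enter in
    decreasing order; \<open>?b l\<close> bounds the oscillations once the sites \<open>l, \<dots>, n - 1\<close> have been applied.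
    Before the application of site \<open>l\<close> the bound at \<open>l\<close> is exactly \<open>k * v l\<close>.\<close>
  let ?b = "\<lambda>l i. k * (if i < l then v i - (\<Sum>j\<in>{i<..<l}. R $$ (i, j) * v j)
                       else \<Sum>j\<in>{l..<i}. R $$ (i, j) * v j)"
  have "osc_bound n q (apply_kernel (foldr (\<lambda>j. kernel_mult (P j)) [l..<n] return_pmf) f) (?b l)"
    if "l \<le> n" for l
    using that
  proof (induction l rule: inc_induct)
    case base
    show ?case
      by (rule osc_bound_cong[OF f]) (auto simp: apply_kernel_def)
  next
    case (step l)
    let ?K = "foldr (\<lambda>j. kernel_mult (P j)) [Suc l..<n] return_pmf"
    have l: "l < n" using step by simp
    from osc_bound_site_update[OF sys dep l diag[OF l] step.IH]
    show ?case
    proof (rule osc_bound_cong)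
      fix x assume x: "x \<in> configs n q"
      have "apply_kernel (kernel_mult (P l) ?K) f x = apply_kernel (P l) (apply_kernel ?K f) x"
        using set_pmf_site[OF sys l x]
        by (intro apply_kernel_mult[where \<Omega> = "configs n q"] finite_configs
            set_pmf_scan_suffix[OF sys]) auto
      then show "apply_kernel (P l) (apply_kernel ?K f) x =
          apply_kernel (foldr (\<lambda>j. kernel_mult (P j)) [l..<n] return_pmf) f x"
        using l by (simp add: upt_conv_Cons)
    next
      fix i assume i: "i < n"
      consider "i < l" | "i = l" | "l < i" by linarith
      then show "(if i = l then 0 else ?b (Suc l) i + R $$ (i, l) * ?b (Suc l) l) \<le> ?b l i"
      proof cases
        case 1
        then have "{i<..<Suc l} = insert l {i<..<l}" "{l<..<Suc l} = {}" by auto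
        with 1 show ?thesis by (simp add: algebra_simps)
      next
        case 3
        then have "{l..<i} = insert l {Suc l..<i}" "{l<..<Suc l} = {}" by auto
        with 3 show ?thesis by (simp add: algebra_simps)
      qed simp
    qed
  qed
  from this[of 0] show ?thesis by (simp add: scan_kernel_def lessThan_atLeast0)
qed

lemma osc_bound_scan_power:
  assumes sys: "spin_system n q \<pi> P"
    and step: "\<And>f k. 0 \<le> k \<Longrightarrow> osc_bound n q f (\<lambda>i. k * w i) \<Longrightarrow>
      osc_bound n q (apply_kernel (scan_kernel n P) f) (\<lambda>i. k * s * w i)"
    and s: "0 \<le> s" and k: "0 \<le> k" and f: "osc_bound n q f (\<lambda>i. k * w i)"
  shows "osc_bound n q (apply_kernel (kernel_power (scan_kernel n P) t) f) (\<lambda>i. k * s ^ t * w i)"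
  using k f
proof (induction t arbitrary: f k)
  case 0
  then show ?case by (auto simp: apply_kernel_def elim!: osc_bound_cong)
next
  case (Suc t)
  have "osc_bound n q (apply_kernel (kernel_power (scan_kernel n P) t) (apply_kernel (scan_kernel n P) f))
      (\<lambda>i. k * s * s ^ t * w i)"
    using Suc.prems s by (intro Suc.IH step) auto
  then show ?case
  proof (rule osc_bound_cong)
    fix x assume x: "x \<in> configs n q"
    show "apply_kernel (kernel_power (scan_kernel n P) t) (apply_kernel (scan_kernel n P) f) x =
        apply_kernel (kernel_power (scan_kernel n P) (Suc t)) f x"
      unfolding kernel_power.simps using x
      by (intro apply_kernel_mult[symmetric, where \<Omega> = "configs n q"] set_pmf_kernel_power
          set_pmf_scan[OF sys] finite_configs)
  qed simp
qed

lemma bind_scan_power: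
  assumes sys: "spin_system n q \<pi> P"
  shows "bind_pmf \<pi> (kernel_power (scan_kernel n P) t) = \<pi>"
proof -
  have "bind_pmf \<pi> (foldr (\<lambda>j. kernel_mult (P j)) js return_pmf) = \<pi>" if "set js \<subseteq> {..<n}" for js
    using that
  proof (induction js)
    case (Cons j js)
    then have "bind_pmf \<pi> (P j) = \<pi>" using sys by (simp add: spin_system_def)
    with Cons show ?case by (simp add: kernel_mult_def flip: bind_assoc_pmf)
  qed (simp add: bind_return_pmf')
  then have scan: "bind_pmf \<pi> (scan_kernel n P) = \<pi>"
    by (simp add: scan_kernel_def lessThan_atLeast0)
  show ?thesis
    by (induction t) (simp_all add: bind_return_pmf' kernel_mult_def scan flip: bind_assoc_pmf)
qed

text \<open>The total variation distance is attained on the event where \<open>p\<close> dominates \<open>p'\<close>.\<close>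

lemma tv_dist_pmf_eq:
  assumes \<Omega>: "finite \<Omega>" and p: "set_pmf p \<subseteq> \<Omega>" "set_pmf p' \<subseteq> \<Omega>"
  defines "f \<equiv> indicat_real {a. pmf p' a \<le> pmf p a}"
  shows "tv_dist \<Omega> (pmf p) (pmf p') = measure_pmf.expectation p f - measure_pmf.expectation p' f"
proof -
  have "sum (pmf p) \<Omega> = 1" "sum (pmf p') \<Omega> = 1"
    using \<Omega> p by (auto intro: sum_pmf_eq_1)
  then have "(\<Sum>a\<in>\<Omega>. pmf p a - pmf p' a) = 0" by (simp add: sum_subtractf)
  moreover have "(\<Sum>a\<in>\<Omega>. \<bar>pmf p a - pmf p' a\<bar>) =
      2 * (\<Sum>a\<in>\<Omega>. (pmf p a - pmf p' a) * f a) - (\<Sum>a\<in>\<Omega>. pmf p a - pmf p' a)"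
    unfolding sum_distrib_left sum_subtractf[symmetric]
    by (intro sum.cong) (auto simp: f_def indicator_def)
  moreover have "measure_pmf.expectation p f = (\<Sum>a\<in>\<Omega>. f a * pmf p a)"
    "measure_pmf.expectation p' f = (\<Sum>a\<in>\<Omega>. f a * pmf p' a)"
    using \<Omega> p by (auto intro!: integral_measure_pmf_real)
  ultimately show ?thesis
    by (simp add: tv_dist_def algebra_simps sum_subtractf)
qed

text \<open>
  By stationarity the expectation of \<open>f\<close> under \<open>\<pi>\<close> is an average of values of \<open>K f\<close>, where \<open>K\<close> is the
  kernel of \<open>t\<close> scans, so its distance from \<open>K f x\<close> is at most the total oscillation of \<open>K f\<close>.
\<close>

lemma tv_dist_scan_power:
  assumes sys: "spin_system n q \<pi> P" and x: "x \<in> configs n q"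
    and osc: "\<And>f. osc_bound n q f (\<lambda>_. 1) \<Longrightarrow>
      osc_bound n q (apply_kernel (kernel_power (scan_kernel n P) t) f) u"
  shows "tv_dist (configs n q) (pmf (kernel_power (scan_kernel n P) t x)) (pmf \<pi>) \<le> (\<Sum>i<n. u i)"
proof -
  let ?\<Omega> = "configs n q" and ?K = "kernel_power (scan_kernel n P) t"
  have K: "set_pmf (?K y) \<subseteq> ?\<Omega>" if "y \<in> ?\<Omega>" for y
    using that by (intro set_pmf_kernel_power set_pmf_scan[OF sys])
  have \<pi>: "set_pmf \<pi> \<subseteq> ?\<Omega>" using sys by (simp add: spin_system_def)
  define f where "f = indicat_real {a. pmf \<pi> a \<le> pmf (?K x) a}"
  have "osc_bound n q f (\<lambda>_. 1)" by (auto simp: osc_bound_def f_def indicator_def)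
  note telescope = osc_bound_telescope[OF osc[OF this] x]
  have le: "apply_kernel ?K f x - (\<Sum>i<n. u i) \<le> apply_kernel ?K f y" if "y \<in> ?\<Omega>" for y
    using telescope[OF that] by simp
  have sum1: "sum (pmf \<pi>) ?\<Omega> = 1" by (rule sum_pmf_eq_1[OF finite_configs \<pi>])
  have "apply_kernel ?K f x - (\<Sum>i<n. u i) = (\<Sum>y\<in>?\<Omega>. pmf \<pi> y * (apply_kernel ?K f x - (\<Sum>i<n. u i)))"
    using sum1 by (simp flip: sum_distrib_right)
  also have "\<dots> \<le> (\<Sum>y\<in>?\<Omega>. pmf \<pi> y * apply_kernel ?K f y)"
    by (intro sum_mono mult_left_mono le) auto
  also have "\<dots> = measure_pmf.expectation (bind_pmf \<pi> ?K) f"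
    using pmf_expectation_bind[OF finite_configs _ \<pi>, of ?K f] finite_subset[OF K finite_configs]
    by (simp add: apply_kernel_def)
  also have "\<dots> = measure_pmf.expectation \<pi> f" by (simp add: bind_scan_power[OF sys])
  finally show ?thesis
    using tv_dist_pmf_eq[OF finite_configs K[OF x] \<pi>] by (simp add: f_def apply_kernel_def)
qed

section \<open>The mixing time\<close>

lemma tv_dist_scan_geometric:
  assumes sys: "spin_system n q \<pi> P" and dep: "dependency_matrix n q P R"
    and sym: "transpose_mat R = R" and diag: "\<And>i. i < n \<Longrightarrow> R $$ (i, i) = 0"
    and s: "0 < s" and c: "0 < c" "(1 + s) * spectral_norm R / 2 \<le> s - c"
    and x: "x \<in> configs n q"
  shows "tv_dist (configs n q) (pmf (kernel_power (scan_kernel n P) t x)) (pmf \<pi>)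
    \<le> s ^ Suc t * (real n / c)"
proof -
  have R: "R \<in> carrier_mat n n" using dep by (simp add: dependency_matrix_def)
  note r = dependency_matrix_nonneg[OF sys dep]
  have sym': "R $$ (i, j) = R $$ (j, i)" if "i < n" "j < n" for i j
    using R that sym by (metis carrier_matD index_transpose_mat(1))
  obtain v where v: "\<And>i. i < n \<Longrightarrow> 0 \<le> v i"
    and eq: "\<And>i. i < n \<Longrightarrow>
      s * (v i - (\<Sum>k\<in>{i<..<n}. R $$ (i, k) * v k)) = 1 + (\<Sum>k<i. R $$ (i, k) * v k)"
    and sum_v: "(\<Sum>i<n. v i) \<le> real n / c"
    using scan_weights[of n "\<lambda>i j. R $$ (i, j)" "spectral_norm R" s c]
      r sym' diag spectral_norm_quadratic_form[OF R] s c by (auto simp: less_imp_le)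
  define w where "w i = v i - (\<Sum>k\<in>{i<..<n}. R $$ (i, k) * v k)" for i
  have w_le: "w i \<le> v i" if "i < n" for i
    using r v that by (auto simp: w_def intro!: sum_nonneg mult_nonneg_nonneg)
  have lower: "0 \<le> (\<Sum>k<i. R $$ (i, k) * v k)" if "i < n" for i
    using r v that by (auto intro!: sum_nonneg mult_nonneg_nonneg)
  have "osc_bound n q (apply_kernel (scan_kernel n P) f) (\<lambda>i. k * s * w i)"
    if k: "0 \<le> k" and f: "osc_bound n q f (\<lambda>i. k * w i)" for f k
  proof (rule osc_bound_cong[OF osc_bound_scan[OF sys dep diag]])
    show "osc_bound n q f (\<lambda>i. k * (v i - (\<Sum>j\<in>{i<..<n}. R $$ (i, j) * v j)))"
      using f by (simp add: w_def)
    show "k * (\<Sum>j<i. R $$ (i, j) * v j) \<le> k * s * w i" if "i < n" for i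
      using eq[OF that] k by (simp add: w_def mult.assoc mult_left_mono)
  qed auto
  note step = this
  have "osc_bound n q (apply_kernel (kernel_power (scan_kernel n P) t) f) (\<lambda>i. s * s ^ t * w i)"
    if f: "osc_bound n q f (\<lambda>_. 1)" for f
  proof (rule osc_bound_scan_power[OF sys step])
    \<comment> \<open>Initially the bounds are \<open>1\<close>, and \<open>1 \<le> s * w i\<close> by the equation for \<open>v\<close>.\<close>
    show "osc_bound n q f (\<lambda>i. s * w i)"
      using eq lower by (intro osc_bound_cong[OF f]) (auto simp: w_def)
  qed (use s in auto)
  from tv_dist_scan_power[OF sys x this]
  have "tv_dist (configs n q) (pmf (kernel_power (scan_kernel n P) t x)) (pmf \<pi>)
      \<le> s ^ Suc t * (\<Sum>i<n. w i)"
    by (simp add: sum_distrib_left)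
  also have "\<dots> \<le> s ^ Suc t * (real n / c)"
    using s w_le by (intro mult_left_mono order_trans[OF sum_mono sum_v]) auto
  finally show ?thesis .
qed

lemma mixing_time_scan_le:
  assumes n: "n \<ge> 1" and sys: "spin_system n q \<pi> P" and dep: "dependency_matrix n q P R"
    and sym: "transpose_mat R = R" and diag: "\<And>i. i < n \<Longrightarrow> R $$ (i, i) = 0"
    and lam: "spectral_norm R = lam" "lam < 1" and eps: "0 < \<epsilon>" "\<epsilon> < 1" and d: "0 < d" "d < 1"
  obtains t where "mixing_time (configs n q) (scan_kernel n P) \<pi> \<epsilon> \<le> enat t"
    and "real t \<le> (1 - lam / 2) * inverse (1 - lam) *
      (ln (inverse (1 - lam) * real n / \<epsilon>) + ln (1 / d)) / (1 - d)"
proof -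
  have R: "R \<in> carrier_mat n n" using dep by (simp add: dependency_matrix_def)
  have lam0: "0 \<le> lam" using spectral_norm_nonneg[OF R n] lam by simp
  define g where "g = (1 - d) * (1 - lam) / (1 - lam / 2)"
  define s where "s = 1 - g"
  define c where "c = d * (1 - lam)"
  have g: "0 < g" using lam d by (simp add: g_def)
  have "(1 - d) * (1 - lam) < 1 * (1 - lam)" using lam d by (intro mult_strict_right_mono) auto
  also have "\<dots> \<le> 1 - lam / 2" using lam0 by simp
  finally have s: "0 < s" using lam lam0 by (simp add: s_def g_def)
  have c: "0 < c" using lam d by (simp add: c_def)
  \<comment> \<open>\<open>c\<close> is chosen so that \<open>s - (1 + s) * lam / 2 = (1 - lam) - g * (1 - lam / 2) = c\<close>.\<close>
  have "g * (1 - lam / 2) = (1 - d) * (1 - lam)" using lam by (simp add: g_def)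
  then have sc: "(1 + s) * lam / 2 \<le> s - c" by (simp add: s_def c_def field_simps)
  define Y where "Y = real n / (c * \<epsilon>)"
  have Y: "0 < Y" using n c eps by (simp add: Y_def)
  have "c * \<epsilon> \<le> 1" using lam lam0 d eps by (simp add: c_def mult_le_one)
  then have "c * \<epsilon> \<le> real n" using n by linarith
  then have "1 \<le> Y" using c eps by (simp add: Y_def)
  define t where "t = nat \<lfloor>ln Y / g\<rfloor>"
  have pos: "0 \<le> ln Y / g" using \<open>1 \<le> Y\<close> g by simp
  have "real t = of_int \<lfloor>ln Y / g\<rfloor>" using pos by (simp add: t_def)
  then have t: "real t \<le> ln Y / g" "ln Y / g < real (Suc t)" by simp_all linarith
  have "s ^ Suc t \<le> exp (- g) ^ Suc t"
    using s exp_ge_add_one_self[of "- g"] by (intro power_mono) (auto simp: s_def)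
  also have "\<dots> = exp (- (g * real (Suc t)))"
    unfolding exp_of_nat_mult[symmetric] by (simp add: mult.commute)
  also have "\<dots> \<le> exp (- ln Y)" using t(2) g by (simp add: field_simps)
  also have "\<dots> = c * \<epsilon> / real n" using Y by (simp add: exp_minus Y_def)
  finally have "s ^ Suc t * (real n / c) \<le> c * \<epsilon> / real n * (real n / c)"
    using c by (intro mult_right_mono) auto
  also have "\<dots> = \<epsilon>" using c n by simp
  finally have "s ^ Suc t * (real n / c) \<le> \<epsilon>" .
  then have "tv_dist (configs n q) (pmf (kernel_power (scan_kernel n P) t x)) (pmf \<pi>) \<le> \<epsilon>"
    if "x \<in> configs n q" for x
    using tv_dist_scan_geometric[OF sys dep sym diag s c _ that, of t] sc lam by simp
  then have "mixing_time (configs n q) (scan_kernel n P) \<pi> \<epsilon> \<le> enat t"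
    unfolding mixing_time_def by (intro INF_lower) simp
  moreover have "ln Y / g = (1 - lam / 2) * inverse (1 - lam) *
      (ln (inverse (1 - lam) * real n / \<epsilon>) + ln (1 / d)) / (1 - d)"
  proof -
    have "Y = inverse (1 - lam) * real n / \<epsilon> * (1 / d)"
      by (simp add: Y_def c_def field_simps)
    then have "ln Y = ln (inverse (1 - lam) * real n / \<epsilon>) + ln (1 / d)"
      using n lam d eps by (simp only:) (rule ln_mult_pos, auto)
    then show ?thesis by (simp add: g_def field_simps)
  qed
  ultimately show thesis using t(1) that by simp
qed

theorem lemma3:
  fixes q :: "nat \<Rightarrow> nat"
    and \<pi> :: "nat \<Rightarrow> config pmf"
    and P :: "nat \<Rightarrow> nat \<Rightarrow> kernel"
    and R :: "nat \<Rightarrow> real mat"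
    and lam :: "nat \<Rightarrow> real"
    and \<epsilon> :: real
  assumes system: "\<And>n. n \<ge> 1 \<Longrightarrow> spin_system n (q n) (\<pi> n) (P n)"
    and dependency: "\<And>n. n \<ge> 1 \<Longrightarrow> dependency_matrix n (q n) (P n) (R n)"
    and symmetric: "\<And>n. n \<ge> 1 \<Longrightarrow> transpose_mat (R n) = R n"
    and zero_diagonal: "\<And>n i. n \<ge> 1 \<Longrightarrow> i < n \<Longrightarrow> R n $$ (i, i) = 0"
    and norm: "\<And>n. n \<ge> 1 \<Longrightarrow> spectral_norm (R n) = lam n"
    and radius: "\<And>n. n \<ge> 1 \<Longrightarrow> spectral_radius (map_mat complex_of_real (R n)) = lam n"
    and less_one: "\<And>n. n \<ge> 1 \<Longrightarrow> lam n < 1"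
    and eps: "0 < \<epsilon>" "\<epsilon> < 1"
  shows "limsup (\<lambda>n.
           ereal_of_enat (mixing_time (configs n (q n)) (scan_kernel n (P n)) (\<pi> n) \<epsilon>) /
           ereal ((1 - lam n / 2) * inverse (1 - lam n) * ln (inverse (1 - lam n) * real n / \<epsilon>)))
         \<le> 1"
    (is "limsup (\<lambda>n. ereal_of_enat (?\<tau> n) / ereal (?T n)) \<le> 1")
proof -
  have bound: "ereal_of_enat (?\<tau> n) / ereal (?T n) \<le> ereal ((1 + ln (1 / d) / ln (real n)) / (1 - d))"
    if n: "n \<ge> 2" and d: "0 < d" "d < 1" for n d
  proof -
    have n1: "n \<ge> 1" using n by simp
    let ?l = "lam n" and ?L = "ln (inverse (1 - lam n) * real n / \<epsilon>)"
    have R: "R n \<in> carrier_mat n n" using dependency[OF n1] by (simp add: dependency_matrix_def)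
    have l: "0 \<le> ?l" "?l < 1"
      using spectral_norm_nonneg[OF R n1] norm[OF n1] less_one[OF n1] by auto
    obtain t where t: "?\<tau> n \<le> enat t"
      "real t \<le> (1 - ?l / 2) * inverse (1 - ?l) * (?L + ln (1 / d)) / (1 - d)"
      using mixing_time_scan_le[OF n1 system[OF n1] dependency[OF n1] symmetric[OF n1]
          zero_diagonal[OF n1] norm[OF n1] less_one[OF n1] eps d] by metis
    have "(1 - ?l) * \<epsilon> \<le> 1" using l eps by (simp add: mult_le_one)
    then have "real n * ((1 - ?l) * \<epsilon>) \<le> real n" by (simp add: mult_left_le)
    then have "real n \<le> inverse (1 - ?l) * real n / \<epsilon>"
      using l eps by (simp add: pos_le_divide_eq divide_inverse mult_ac flip: inverse_mult_distrib)
        (simp add: field_simps)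
    then have L: "ln (real n) \<le> ?L" using n by (intro ln_mono) auto
    have ln_n: "0 < ln (real n)" using n by simp
    define A where "A = (1 - ?l / 2) * inverse (1 - ?l)"
    have A: "0 < A" using l by (simp add: A_def)
    define T where "T = A * ?L"
    have T: "?T n = T" "0 < T" using A L ln_n by (auto simp: A_def T_def)
    have "ereal_of_enat (?\<tau> n) \<le> ereal (real t)"
      using t(1) by (metis ereal_of_enat_le_iff ereal_of_enat_simps(1))
    then have "ereal_of_enat (?\<tau> n) / ereal (?T n) \<le> ereal (real t) / ereal T"
      unfolding T(1) using T(2) by (intro ereal_divide_right_mono) auto
    also have "\<dots> = ereal (real t / T)" using T(2) by simp
    also have "real t / T \<le> A * (?L + ln (1 / d)) / (1 - d) / T"
      using t(2) T(2) unfolding A_def by (intro divide_right_mono) auto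
    also have "\<dots> = (1 + ln (1 / d) / ?L) / (1 - d)"
      unfolding T_def using A L ln_n d by (simp add: divide_simps)
    also have "\<dots> \<le> (1 + ln (1 / d) / ln (real n)) / (1 - d)"
      using L ln_n d by (intro divide_right_mono add_left_mono divide_left_mono) auto
    finally show ?thesis by simp
  qed
  \<comment> \<open>Let \<open>n\<close> tend to infinity with \<open>d\<close> fixed.\<close>
  have d_bound: "limsup (\<lambda>n. ereal_of_enat (?\<tau> n) / ereal (?T n)) \<le> ereal (1 / (1 - d))"
    if d: "0 < d" "d < 1" for d
  proof -
    have "limsup (\<lambda>n. ereal_of_enat (?\<tau> n) / ereal (?T n)) \<le>
        limsup (\<lambda>n. ereal ((1 + ln (1 / d) / ln (real n)) / (1 - d)))"
      using bound d by (intro Limsup_mono eventually_sequentiallyI[of 2]) auto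
    also have "\<dots> = ereal ((1 + 0) / (1 - d))"
    proof (intro lim_imp_Limsup tendsto_intros)
      show "((\<lambda>n. ln (1 / d) / ln (real n)) \<longlongrightarrow> 0) sequentially"
        by (rule real_tendsto_divide_at_top[OF tendsto_const
              filterlim_compose[OF ln_at_top filterlim_real_sequentially]])
    qed (use d in auto)
    finally show ?thesis by simp
  qed
  \<comment> \<open>Let \<open>d\<close> tend to \<open>0\<close>.\<close>
  have "((\<lambda>d. ereal (1 / (1 - d))) \<longlongrightarrow> ereal (1 / (1 - 0))) (at_right 0)"
    by (intro tendsto_intros) auto
  then show ?thesis
    using tendsto_lowerbound[of "\<lambda>d. ereal (1 / (1 - d))" _ "at_right 0"] d_bound
    by (force simp: one_ereal_def eventually_at_right_field intro: exI[of _ 1])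
qed

end
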